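(* For every $c,n>1$ there is a deterministic algorithm for the Shift Finding problem $\mathsf{ShiftFinding}_{c,n}$ that makes $O(\sqrt{cn})$ queries.
   Context: Shift Finding $\mathsf{ShiftFinding}_{c,n}$: the input is a string $P\in\{0,1\}^{(c-1)n}$ (fully known to the algorithm), and the algorithm has query access to a string $F_{s^*}$ which is the concatenation of $n-s^*$ zeros, then $P$, then $s^*$ ones, for an unknown $s^*\in[0,n]$; a query at $x\in[0,cn]$ returns $F_{s^*}(x)$. The goal is to output $s^*$ exactly; the complexity is the number of queries made to $F_{s^*}$. *)

theory Defs
  imports Complex_Main
begin

text \<open>
  A deterministic adaptive query algorithm is a decision tree: a query at a position
  continues according to the bit received. Positions are counted from 0.
\<close>

datatype query_alg = Output nat | Query nat "bool \<Rightarrow> query_alg"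

primrec result :: "query_alg \<Rightarrow> bool list \<Rightarrow> nat" where
  "result (Output s) F = s"
| "result (Query x k) F = result (k (F ! x)) F"

primrec queries :: "query_alg \<Rightarrow> bool list \<Rightarrow> nat list" where
  "queries (Output s) F = []"
| "queries (Query x k) F = x # queries (k (F ! x)) F"

text \<open>\<^const>\<open>False\<close> is the symbol 0 and \<^const>\<open>True\<close> is the symbol 1.\<close>

definition shifted :: "nat \<Rightarrow> bool list \<Rightarrow> nat \<Rightarrow> bool list" where
  "shifted n P s = replicate (n - s) False @ P @ replicate s True"

text \<open>
  The parameter \<open>c\<close> may be any real number; there are inputs only if \<open>(c - 1) * n\<close> is a
  natural number.
\<close>

definition shift_finding_inputs :: "real \<Rightarrow> nat \<Rightarrow> (bool list \<times> nat) set" where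
  "shift_finding_inputs c n = {(P, s). real (length P) = (c - 1) * real n \<and> s \<le> n}"

text \<open>
  The pattern \<open>P\<close> is known to the algorithm, so the decision tree may depend on it in an
  arbitrary way. All queries must fall inside the string, since \<^const>\<open>nth\<close> is
  unspecified elsewhere.
\<close>

definition solves_shift_finding :: "real \<Rightarrow> nat \<Rightarrow> (bool list \<Rightarrow> query_alg) \<Rightarrow> bool" where
  "solves_shift_finding c n A \<longleftrightarrow>
     (\<forall>(P, s) \<in> shift_finding_inputs c n.
        set (queries (A P) (shifted n P s)) \<subseteq> {..<length (shifted n P s)} \<and>
        result (A P) (shifted n P s) = s)"

end

theory Submission
  imports Defs
begin

text \<open>
  Put \<open>L = c n\<close> and \<open>k = \<lceil>\<surd>L\<rceil>\<close>. First query all multiples of \<open>k\<close>. Suppose that two shifts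
  \<open>s < t\<close> with \<open>k\<close> dividing \<open>d = t - s\<close> give the same answers. Since \<open>F\<^sub>t\<close> is \<open>F\<^sub>s\<close> moved by \<open>d\<close>,
  the string \<open>F\<^sub>s\<close> is constant on the multiples of \<open>d\<close>. Hence \<open>F\<^sub>t\<close> at the last multiple of
  \<open>d\<close> below \<open>L\<close> has the same value as \<open>F\<^sub>s\<close> at 0; but the former lies in the final ones and the
  latter in the initial zeros. So at most one shift per residue class modulo \<open>k\<close> survives, and
  each further query that separates two survivors eliminates at least one of them.
\<close>

lemma length_shifted [simp]: "s \<le> n \<Longrightarrow> length (shifted n P s) = n + length P"
  by (simp add: shifted_def)

text \<open>All shifted strings are windows of the single string consisting of \<open>n\<close>
  zeros, \<open>P\<close> and \<open>n\<close> ones, the window for \<open>s\<close> starting at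
  \<open>s\<close>. Changing the shift thus amounts to translating positions.\<close>

lemma shifted_nth:
  assumes "s \<le> n" "x < n + length P"
  shows "shifted n P s ! x = (replicate n False @ P @ replicate n True) ! (x + s)"
proof -
  have "x + s - n = x - (n - s)" if "\<not> x < n - s"
    using that assms by linarith
  then show ?thesis
    using assms by (auto simp: shifted_def nth_append)
qed

text \<open>Serves twice: with the grid width \<open>k\<close> it limits the survivors of the first
  phase, and with \<open>k = 1\<close> it shows that distinct shifts give distinct strings.\<close>

lemma shifted_residue_unique:
  assumes "s \<le> n" "t \<le> n" "s mod k = t mod k"
    and agree: "\<And>x. k dvd x \<Longrightarrow> x < n + length P \<Longrightarrow> shifted n P s ! x = shifted n P t ! x"
  shows "s = t"
  using assms
proof (induction s t rule: linorder_wlog)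
  case (le s t)
  show ?case
  proof (rule ccontr)
    assume "s \<noteq> t"
    define L where "L = n + length P"
    define d where "d = t - s"
    have d: "0 < d" "t = s + d" and "s < n" "t \<le> n"
      using le \<open>s \<noteq> t\<close> by (auto simp: d_def)
    have "k dvd d"
      using mod_eq_dvd_iff_nat[OF le.hyps, of k] le.prems(3) by (simp add: d_def)
    \<comment> \<open>Start in the initial zeros of \<open>s\<close>. Agreement at
      \<open>i * d\<close> passes the value to \<open>t\<close>, and translation by \<open>d\<close>
      passes it back to \<open>s\<close> at \<open>Suc i * d\<close>.\<close>
    have zero: "\<not> shifted n P s ! (i * d)" if "i * d < L" for i
      using that
    proof (induction i)
      case 0
      then show ?case using \<open>s < n\<close> by (simp add: shifted_nth nth_append L_def)
    next
      case (Suc i)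
      then have "\<not> shifted n P s ! (i * d)" by simp
      moreover have "shifted n P s ! (i * d) = shifted n P t ! (i * d)"
        using Suc.prems \<open>k dvd d\<close> by (intro le.prems) (auto simp: L_def)
      moreover have "shifted n P t ! (i * d) = shifted n P s ! (Suc i * d)"
        using Suc.prems le.prems d by (simp add: shifted_nth L_def add_ac)
      ultimately show ?case by simp
    qed
    \<comment> \<open>\<open>j * d\<close> is the last multiple of \<open>d\<close> below
      \<open>L\<close>. It is within \<open>d \<le> t\<close> of the end, hence among the
      \<open>t\<close> final ones of the string for \<open>t\<close>.\<close>
    define j where "j = (L - 1) div d"
    have "0 < L" using \<open>s < n\<close> by (simp add: L_def)
    have "j * d \<le> L - 1" by (simp add: j_def)
    then have j: "j * d < L" using \<open>0 < L\<close> by linarith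
    have "L - 1 < j * d + d"
      using dividend_less_div_times[OF \<open>0 < d\<close>, of "L - 1"] by (simp add: j_def add.commute)
    then have "L \<le> j * d + t" using d by linarith
    then have "\<not> j * d + t < n" "\<not> j * d + t - n < length P" "j * d + t - n - length P < n"
      using j \<open>t \<le> n\<close> by (auto simp: L_def)
    then have "shifted n P t ! (j * d)"
      using j \<open>t \<le> n\<close> by (simp add: shifted_nth nth_append L_def)
    moreover have "shifted n P s ! (j * d) = shifted n P t ! (j * d)"
      using j \<open>k dvd d\<close> by (intro le.prems) (auto simp: L_def)
    ultimately show False using zero[OF j] by simp
  qed
next
  case (sym s t)
  have "t = s" by (rule sym.IH) (use sym.prems in auto)
  then show ?case ..
qed

text \<open>Induction on the candidate set: query a position where two candidates differ. Whatever
  the answer, one of them is refuted, so the set shrinks strictly.\<close>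

lemma eliminate_candidates:
  fixes F :: "nat \<Rightarrow> bool list"
  assumes "finite S"
    and "\<And>s t. s \<in> S \<Longrightarrow> t \<in> S \<Longrightarrow> (\<And>x. x < L \<Longrightarrow> F s ! x = F t ! x) \<Longrightarrow> s = t"
  shows "\<exists>A. \<forall>s\<in>S. set (queries A (F s)) \<subseteq> {..<L} \<and> result A (F s) = s \<and>
    length (queries A (F s)) \<le> card S"
  using assms
proof (induction S rule: finite_psubset_induct)
  case (psubset S)
  show ?case
  proof (cases "\<exists>s\<in>S. \<exists>t\<in>S. s \<noteq> t")
    case False
    then obtain a where "\<forall>s\<in>S. s = a" by blast
    then show ?thesis by (intro exI[of _ "Output a"]) auto
  next
    case True
    then obtain s t x where st: "s \<in> S" "t \<in> S" "x < L" "F s ! x \<noteq> F t ! x"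
      using psubset.prems by metis
    define R where "R b = {u \<in> S. F u ! x = b}" for b
    have R: "R b \<subset> S" for b
      using st by (auto simp: R_def)
    have "\<exists>A. \<forall>s\<in>R b. set (queries A (F s)) \<subseteq> {..<L} \<and> result A (F s) = s \<and>
        length (queries A (F s)) \<le> card (R b)" for b
      using R psubset.prems by (intro psubset.IH) (auto simp: R_def)
    then obtain K where K: "\<And>b s. s \<in> R b \<Longrightarrow> set (queries (K b) (F s)) \<subseteq> {..<L} \<and>
        result (K b) (F s) = s \<and> length (queries (K b) (F s)) \<le> card (R b)"
      by metis
    have card: "card (R b) < card S" for b
      using R psubset.hyps by (simp add: psubset_card_mono)
    show ?thesis
    proof (intro exI[of _ "Query x K"] ballI)
      fix u assume "u \<in> S"
      then have "u \<in> R (F u ! x)" by (simp add: R_def)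
      from K[OF this] card[of "F u ! x"] \<open>x < L\<close>
      show "set (queries (Query x K) (F u)) \<subseteq> {..<L} \<and> result (Query x K) (F u) = u \<and>
          length (queries (Query x K) (F u)) \<le> card S"
        by simp
    qed
  qed
qed

text \<open>Ask the fixed queries \<open>xs\<close> first, then eliminate. The last assumption
  bounds each class of candidates that \<open>xs\<close> cannot tell apart; ranging over all subsets
  \<open>T\<close>, it survives the restriction of \<open>S\<close> to those matching an
  answer.\<close>

lemma query_then_eliminate:
  fixes F :: "nat \<Rightarrow> bool list"
  assumes "finite S" "set xs \<subseteq> {..<L}"
    and "\<And>s t. s \<in> S \<Longrightarrow> t \<in> S \<Longrightarrow> (\<And>x. x < L \<Longrightarrow> F s ! x = F t ! x) \<Longrightarrow> s = t"
    and "\<And>T. T \<subseteq> S \<Longrightarrow> (\<And>s t x. s \<in> T \<Longrightarrow> t \<in> T \<Longrightarrow> x \<in> set xs \<Longrightarrow> F s ! x = F t ! x) \<Longrightarrow>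
      card T \<le> k"
  shows "\<exists>A. \<forall>s\<in>S. set (queries A (F s)) \<subseteq> {..<L} \<and> result A (F s) = s \<and>
    length (queries A (F s)) \<le> length xs + k"
  using assms
proof (induction xs arbitrary: S)
  case Nil
  \<comment> \<open>With no queries left, agreement on \<open>xs\<close> is vacuous, so
    \<open>T = S\<close> is allowed.\<close>
  then have "card S \<le> k" by simp
  moreover obtain A where "\<forall>s\<in>S. set (queries A (F s)) \<subseteq> {..<L} \<and> result A (F s) = s \<and>
      length (queries A (F s)) \<le> card S"
    using eliminate_candidates[of S L F] Nil.prems by blast
  ultimately show ?case by (intro exI[of _ A]) fastforce
next
  case (Cons x xs)
  define R where "R b = {u \<in> S. F u ! x = b}" for b
  have "\<exists>A. \<forall>s\<in>R b. set (queries A (F s)) \<subseteq> {..<L} \<and> result A (F s) = s \<and>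
      length (queries A (F s)) \<le> length xs + k" for b
  proof (rule Cons.IH)
    show "card T \<le> k"
      if "T \<subseteq> R b" "\<And>s t x. s \<in> T \<Longrightarrow> t \<in> T \<Longrightarrow> x \<in> set xs \<Longrightarrow> F s ! x = F t ! x" for T
    proof (rule Cons.prems(4))
      show "T \<subseteq> S" using that(1) by (auto simp: R_def)
      show "F s ! y = F t ! y" if "s \<in> T" "t \<in> T" "y \<in> set (x # xs)" for s t y
        using that \<open>T \<subseteq> R b\<close> \<open>\<And>s t x. s \<in> T \<Longrightarrow> t \<in> T \<Longrightarrow> x \<in> set xs \<Longrightarrow> F s ! x = F t ! x\<close>
        by (auto simp: R_def subset_iff)
    qed
  qed (use Cons.prems in \<open>auto simp: R_def\<close>)
  then obtain K where "\<And>b s. s \<in> R b \<Longrightarrow> set (queries (K b) (F s)) \<subseteq> {..<L} \<and>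
      result (K b) (F s) = s \<and> length (queries (K b) (F s)) \<le> length xs + k"
    by metis
  then show ?case
    using Cons.prems(2) by (intro exI[of _ "Query x K"]) (auto simp: R_def)
qed

lemma shift_finding_alg:
  assumes "0 < k" "n + length P \<le> k * k"
  shows "\<exists>A. \<forall>s\<le>n. set (queries A (shifted n P s)) \<subseteq> {..<n + length P} \<and>
    result A (shifted n P s) = s \<and> length (queries A (shifted n P s)) \<le> 2 * k"
proof -
  define L where "L = n + length P"
  \<comment> \<open>Since \<open>L \<le> k * k\<close>, these \<open>k\<close> multiples reach all
    those below \<open>L\<close>; the filter drops positions outside the string.\<close>
  define xs where "xs = filter (\<lambda>x. x < L) (map (\<lambda>i. i * k) [0..<k])"
  have xs: "x \<in> set xs" if "k dvd x" "x < L" for x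
  proof -
    obtain i where "x = i * k" using \<open>k dvd x\<close> by (metis dvd_def mult.commute)
    moreover from this have "i * k < k * k"
      using that(2) assms(2) unfolding L_def by (metis less_le_trans)
    then have "i < k" by simp
    ultimately show ?thesis using that by (auto simp: xs_def)
  qed
  have "length xs \<le> k"
    unfolding xs_def by (rule order_trans[OF length_filter_le]) simp
  have "\<exists>A. \<forall>s\<in>{..n}. set (queries A (shifted n P s)) \<subseteq> {..<L} \<and>
    result A (shifted n P s) = s \<and> length (queries A (shifted n P s)) \<le> length xs + k"
  proof (rule query_then_eliminate[where F = "shifted n P"])
    show "s = t" if "s \<in> {..n}" "t \<in> {..n}" "\<And>x. x < L \<Longrightarrow> shifted n P s ! x = shifted n P t ! x"
      for s t
      by (rule shifted_residue_unique[of s n t 1 P]) (use that in \<open>simp_all add: L_def\<close>)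
    show "card T \<le> k"
      if T: "T \<subseteq> {..n}"
        "\<And>s t x. s \<in> T \<Longrightarrow> t \<in> T \<Longrightarrow> x \<in> set xs \<Longrightarrow> shifted n P s ! x = shifted n P t ! x" for T
    proof -
      \<comment> \<open>Survivors have distinct residues, and there are only \<open>k\<close>
        residues.\<close>
      have "inj_on (\<lambda>s. s mod k) T"
      proof (rule inj_onI)
        fix s t assume st: "s \<in> T" "t \<in> T" "s mod k = t mod k"
        show "s = t"
        proof (rule shifted_residue_unique[OF _ _ st(3)])
          show "s \<le> n" "t \<le> n" using st T(1) by auto
          show "shifted n P s ! x = shifted n P t ! x" if "k dvd x" "x < n + length P" for x
            using st that by (intro T(2) xs) (simp_all add: L_def)
        qed
      qed
      moreover have "(\<lambda>s. s mod k) ` T \<subseteq> {..<k}" using \<open>0 < k\<close> by auto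
      ultimately show ?thesis using card_inj_on_le[of _ T "{..<k}"] by simp
    qed
  qed (auto simp: xs_def)
  then obtain A where A: "\<And>s. s \<le> n \<Longrightarrow> set (queries A (shifted n P s)) \<subseteq> {..<L} \<and>
      result A (shifted n P s) = s \<and> length (queries A (shifted n P s)) \<le> length xs + k"
    by auto
  show ?thesis
  proof (intro exI[of _ A] allI impI)
    fix s assume "s \<le> n"
    from A[OF this] \<open>length xs \<le> k\<close>
    show "set (queries A (shifted n P s)) \<subseteq> {..<n + length P} \<and>
        result A (shifted n P s) = s \<and> length (queries A (shifted n P s)) \<le> 2 * k"
      by (simp add: L_def)
  qed
qed

theorem theorem1p8:
  shows "\<exists>C::real. C > 0 \<and>
    (\<forall>(c::real) (n::nat). c > 1 \<and> n > 1 \<longrightarrow>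
      (\<exists>A. solves_shift_finding c n A \<and>
        (\<forall>(P, s) \<in> shift_finding_inputs c n.
           real (length (queries (A P) (shifted n P s))) \<le> C * sqrt (c * real n))))"
\<comment> \<open>Rounding up gives \<open>2 * k \<le> 2 * sqrt (c * n) + 2\<close>, and the 2 is
  absorbed because \<open>sqrt (c * n) \<ge> 1\<close>.\<close>
proof (intro exI[of _ 4] conjI allI impI)
  fix c :: real and n :: nat
  assume cn: "c > 1 \<and> n > 1"
  define k where "k = nat \<lceil>sqrt (c * n)\<rceil>"
  have "1 * 1 \<le> c * real n"
    using cn by (intro mult_mono) auto
  then have sqrt: "1 \<le> sqrt (c * n)" by simp
  then have k: "sqrt (c * n) \<le> k" "real k \<le> sqrt (c * n) + 1" "0 < k"
    unfolding k_def by linarith+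
  have "\<exists>A. \<forall>s\<le>n. set (queries A (shifted n P s)) \<subseteq> {..<n + length P} \<and>
    result A (shifted n P s) = s \<and> length (queries A (shifted n P s)) \<le> 2 * k"
    if "real (length P) = (c - 1) * real n" for P
  proof (rule shift_finding_alg)
    have "real (n + length P) = c * n" using that by (simp add: algebra_simps)
    also have "\<dots> = sqrt (c * n) * sqrt (c * n)" using cn by simp
    also have "\<dots> \<le> real k * real k" using k(1) sqrt by (intro mult_mono) auto
    finally show "n + length P \<le> k * k"
      by (metis of_nat_le_iff of_nat_mult)
  qed (fact k(3))
  then obtain A where A: "\<And>P s. real (length P) = (c - 1) * real n \<Longrightarrow> s \<le> n \<Longrightarrow>
      set (queries (A P) (shifted n P s)) \<subseteq> {..<n + length P} \<and>
      result (A P) (shifted n P s) = s \<and> length (queries (A P) (shifted n P s)) \<le> 2 * k"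
    by metis
  have "real (length (queries (A P) (shifted n P s))) \<le> 4 * sqrt (c * n)"
    if "(P, s) \<in> shift_finding_inputs c n" for P s
  proof -
    have "length (queries (A P) (shifted n P s)) \<le> 2 * k"
      using that A by (simp add: shift_finding_inputs_def)
    then show ?thesis using k(2) sqrt by linarith
  qed
  moreover have "solves_shift_finding c n A"
    using A by (auto simp: solves_shift_finding_def shift_finding_inputs_def)
  ultimately show "\<exists>A. solves_shift_finding c n A \<and>
        (\<forall>(P, s) \<in> shift_finding_inputs c n.
           real (length (queries (A P) (shifted n P s))) \<le> 4 * sqrt (c * real n))"
    by blast
qed simp

end
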